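(* Let $X$ be a normal space such that every one-point subset of $X$ is $G_\delta$. Then the following hold. (i) A non-zero ideal $I$ of $B_1(X)$ is minimal if and only if, for some $p\in X$, $I$ is generated by $\chi_{\{p\}}$. (ii) A non-zero ideal $I$ of $B_1(X)$ is minimal if and only if $|Z[I]|=2$. (iii) The socle of $B_1(X)$ consists of all functions which vanish everywhere except on a finite subset of $X$. (iv) The socle of $B_1(X)$ is an essential ideal which is also free. (v) The socle of $B_1(X)$ is the intersection of all free ideals in $B_1(X)$, and of all free ideals in $B_1^*(X)$.
   Context: All topological spaces are nonempty and $T_1$; in particular normal spaces are $T_1$. $F(X)$ is the ring of all functions $X\to\mathbb{R}$ with pointwise addition and multiplication, and $C(X)$ is its subring of continuous functions. $B_1(X)$ (the ring of Baire one functions) is the subring of $F(X)$ consisting of all pointwise limits of sequences in $C(X)$, and $B_1^*(X)$ is the subring of bounded members of $B_1(X)$. $\chi_S$ is the characteristic function of $S\subseteq X$. For a function $f$, $Z(f)=\{x\in X: f(x)=0\}$, and for an ideal $I$, $Z[I]=\{Z(f): f\in I\}$. A proper ideal $I$ of $B_1(X)$ is called fixed if $\bigcap Z[I]\neq\emptyset$, and otherwise it is called free; the same terminology is used for proper ideals of $B_1^*(X)$. A minimal ideal is a non-zero ideal that properly contains no non-zero ideal. A non-zero ideal of a commutative ring $R$ is essential if it intersects every non-zero ideal of $R$ nontrivially. The socle of $R$ is the sum of all minimal ideals of $R$ (equivalently, for the semiprime rings considered here, the intersection of all essential ideals of $R$).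
   Formalization: In (iv), that the socle is free (hence proper) is claimed only for infinite X; for finite X the socle is all of B_1(X), so not proper, and only ⋂Z[socle]=∅ is claimed. In (v), an empty family of free ideals (finite X) has the whole ring as its intersection. *)

theory Defs
  imports "HOL-Analysis.Analysis" "HOL-Algebra.Algebra"
begin

section \<open>Rings of real-valued functions\<close>

definition fun_ring :: "('a \<Rightarrow> real) ring" where
  "fun_ring = \<lparr>carrier = UNIV,
               mult = (\<lambda>f g x. f x * g x), one = (\<lambda>x. 1),
               ring.zero = (\<lambda>x. 0), ring.add = (\<lambda>f g x. f x + g x)\<rparr>"

definition baire_one :: "('a::topological_space \<Rightarrow> real) \<Rightarrow> bool" where
  "baire_one f \<longleftrightarrow>
     (\<exists>g :: nat \<Rightarrow> 'a \<Rightarrow> real. (\<forall>n. continuous_on UNIV (g n)) \<and> (\<forall>x. (\<lambda>n. g n x) \<longlonglongrightarrow> f x))"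

definition B1 :: "('a::topological_space \<Rightarrow> real) ring" where
  "B1 = fun_ring\<lparr>carrier := {f. baire_one f}\<rparr>"

definition B1_star :: "('a::topological_space \<Rightarrow> real) ring" where
  "B1_star = fun_ring\<lparr>carrier := {f. baire_one f \<and> bounded (range f)}\<rparr>"

lemma cring_fun_ring: "cring (fun_ring :: ('a \<Rightarrow> real) ring)"
proof (rule cringI)
  show "abelian_group (fun_ring :: ('a \<Rightarrow> real) ring)"
  proof (rule abelian_groupI)
    fix f :: "'a \<Rightarrow> real"
    show "\<exists>g \<in> carrier fun_ring. g \<oplus>\<^bsub>fun_ring\<^esub> f = \<zero>\<^bsub>fun_ring\<^esub>"
      by (rule bexI[of _ "\<lambda>x. - f x"]) (auto simp: fun_ring_def)
  qed (auto simp: fun_ring_def)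
  show "comm_monoid (fun_ring :: ('a \<Rightarrow> real) ring)"
    by (rule comm_monoidI) (auto simp: fun_ring_def)
qed (auto simp: fun_ring_def algebra_simps)

lemma uminus_fun_ring: "\<ominus>\<^bsub>fun_ring\<^esub> f = (\<lambda>x. - f x)" for f :: "'a \<Rightarrow> real"
proof -
  interpret cring "fun_ring :: ('a \<Rightarrow> real) ring" by (rule cring_fun_ring)
  have "(\<lambda>x. - f x) \<oplus>\<^bsub>fun_ring\<^esub> f = \<zero>\<^bsub>fun_ring\<^esub>"
    by (auto simp: fun_ring_def)
  then show ?thesis
    by (intro minus_equality) (auto simp: fun_ring_def)
qed

lemma baire_one_const: "baire_one (\<lambda>x. c)"
  unfolding baire_one_def by (rule exI[of _ "\<lambda>n x. c"]) auto

lemma baire_one_minus: "baire_one f \<Longrightarrow> baire_one (\<lambda>x. - f x)"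
  unfolding baire_one_def
  by (elim exE, rule_tac x = "\<lambda>n x. - g n x" in exI) (auto intro!: continuous_intros tendsto_intros)

lemma baire_one_add:
  assumes "baire_one f" and "baire_one g"
  shows "baire_one (\<lambda>x. f x + g x)"
proof -
  obtain u v :: "nat \<Rightarrow> 'a \<Rightarrow> real"
    where "\<And>n. continuous_on UNIV (u n)" "\<And>x. (\<lambda>n. u n x) \<longlonglongrightarrow> f x"
      and "\<And>n. continuous_on UNIV (v n)" "\<And>x. (\<lambda>n. v n x) \<longlonglongrightarrow> g x"
    using assms unfolding baire_one_def by blast
  then show ?thesis
    unfolding baire_one_def
    by (intro exI[of _ "\<lambda>n x. u n x + v n x"]) (auto intro!: continuous_intros tendsto_intros)
qed

lemma baire_one_mult:
  assumes "baire_one f" and "baire_one g"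
  shows "baire_one (\<lambda>x. f x * g x)"
proof -
  obtain u v :: "nat \<Rightarrow> 'a \<Rightarrow> real"
    where "\<And>n. continuous_on UNIV (u n)" "\<And>x. (\<lambda>n. u n x) \<longlonglongrightarrow> f x"
      and "\<And>n. continuous_on UNIV (v n)" "\<And>x. (\<lambda>n. v n x) \<longlonglongrightarrow> g x"
    using assms unfolding baire_one_def by blast
  then show ?thesis
    unfolding baire_one_def
    by (intro exI[of _ "\<lambda>n x. u n x * v n x"]) (auto intro!: continuous_intros tendsto_intros)
qed

lemma bounded_range_mult:
  fixes f g :: "'a \<Rightarrow> real"
  assumes "bounded (range f)" and "bounded (range g)"
  shows "bounded (range (\<lambda>x. f x * g x))"
proof -
  obtain a b where "\<And>x. \<bar>f x\<bar> \<le> a" and "\<And>x. \<bar>g x\<bar> \<le> b"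
    using assms by (auto simp: bounded_iff)
  then have "\<bar>f x * g x\<bar> \<le> a * b" for x
    by (metis abs_ge_zero abs_mult mult_mono order_trans)
  then show ?thesis
    by (auto simp: bounded_iff)
qed

lemma bounded_range_add:
  fixes f g :: "'a \<Rightarrow> real"
  assumes "bounded (range f)" and "bounded (range g)"
  shows "bounded (range (\<lambda>x. f x + g x))"
  using assms by (rule bounded_plus_comp)

lemma subcring_B1: "subcring {f :: 'a::topological_space \<Rightarrow> real. baire_one f} fun_ring"
proof -
  interpret cring "fun_ring :: ('a \<Rightarrow> real) ring" by (rule cring_fun_ring)
  show ?thesis
    by (rule subcringI', rule subringI)
       (auto simp: uminus_fun_ring intro!: baire_one_minus,
        auto simp: fun_ring_def intro!: baire_one_const baire_one_add baire_one_mult)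
qed

lemma subcring_B1_star:
  "subcring {f :: 'a::topological_space \<Rightarrow> real. baire_one f \<and> bounded (range f)} fun_ring"
proof -
  interpret cring "fun_ring :: ('a \<Rightarrow> real) ring" by (rule cring_fun_ring)
  show ?thesis
    by (rule subcringI', rule subringI)
       (auto simp: uminus_fun_ring intro!: baire_one_minus,
        auto simp: fun_ring_def intro!: baire_one_const baire_one_add baire_one_mult
          bounded_range_add bounded_range_mult)
qed

lemma cring_B1: "cring B1"
  unfolding B1_def
  by (rule ring.subcring_iff[OF cring.axioms(1)[OF cring_fun_ring], THEN iffD1])
     (simp_all add: subcring_B1, simp add: fun_ring_def)

lemma cring_B1_star: "cring B1_star"
  unfolding B1_star_def
  by (rule ring.subcring_iff[OF cring.axioms(1)[OF cring_fun_ring], THEN iffD1])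
     (simp_all add: subcring_B1_star, simp add: fun_ring_def)


section \<open>Minimal ideals, essential ideals and the socle\<close>

definition minimal_ideal :: "('r, 'm) ring_scheme \<Rightarrow> 'r set \<Rightarrow> bool" where
  "minimal_ideal R I \<longleftrightarrow>
     ideal I R \<and> I \<noteq> {\<zero>\<^bsub>R\<^esub>} \<and> \<not> (\<exists>J. ideal J R \<and> J \<noteq> {\<zero>\<^bsub>R\<^esub>} \<and> J \<subset> I)"

definition essential_ideal :: "('r, 'm) ring_scheme \<Rightarrow> 'r set \<Rightarrow> bool" where
  "essential_ideal R I \<longleftrightarrow>
     ideal I R \<and> I \<noteq> {\<zero>\<^bsub>R\<^esub>} \<and>
     (\<forall>J. ideal J R \<and> J \<noteq> {\<zero>\<^bsub>R\<^esub>} \<longrightarrow> I \<inter> J \<noteq> {\<zero>\<^bsub>R\<^esub>})"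

text \<open>The sum of a (possibly infinite) family of ideals consists of the finite sums of elements
  taken from distinct members of the family.\<close>

definition sum_of_ideals :: "('r, 'm) ring_scheme \<Rightarrow> 'r set set \<Rightarrow> 'r set" where
  "sum_of_ideals R \<I> = {finsum R a \<F> | a \<F>. finite \<F> \<and> \<F> \<subseteq> \<I> \<and> (\<forall>I\<in>\<F>. a I \<in> I)}"

definition socle :: "('r, 'm) ring_scheme \<Rightarrow> 'r set" where
  "socle R = sum_of_ideals R {I. minimal_ideal R I}"


section \<open>Zero sets and free ideals\<close>

definition zero_set :: "('a \<Rightarrow> real) \<Rightarrow> 'a set" where
  "zero_set f = {x. f x = 0}"

definition zero_sets :: "('a \<Rightarrow> real) set \<Rightarrow> 'a set set" where
  "zero_sets I = zero_set ` I"

text \<open>Only proper ideals are classified as fixed or free.  Over a finite \<open>T\<^sub>1\<close> space every proper ideal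
  of \<open>B1\<close> is fixed, and the socle of \<open>B1\<close> is the whole ring, hence neither fixed nor free.\<close>

definition fixed_ideal :: "('a \<Rightarrow> real) ring \<Rightarrow> ('a \<Rightarrow> real) set \<Rightarrow> bool" where
  "fixed_ideal R I \<longleftrightarrow> ideal I R \<and> I \<noteq> carrier R \<and> \<Inter> (zero_sets I) \<noteq> {}"

definition free_ideal :: "('a \<Rightarrow> real) ring \<Rightarrow> ('a \<Rightarrow> real) set \<Rightarrow> bool" where
  "free_ideal R I \<longleftrightarrow> ideal I R \<and> I \<noteq> carrier R \<and> \<not> fixed_ideal R I"

end

theory Submission
  imports Defs
begin

text \<open>If \<open>f\<close> lies in an ideal and \<open>f p \<noteq> 0\<close>, then multiplying \<open>f\<close> by \<open>\<chi>\<^bsub>{p}\<^esub> / f p\<close> shows that the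
  ideal contains every function vanishing off \<open>p\<close>; the argument only needs a ring of functions that
  contains all functions of finite support. That \<open>B1\<close> is such a ring is where the topology enters:
  by normality and the \<open>G\<^sub>\<delta>\<close> hypothesis, \<open>\<chi>\<^bsub>{p}\<^esub>\<close> is a pointwise limit of Urysohn functions. If
  \<open>f\<close> has infinite support, then the functions \<open>g\<close> for which \<open>g f\<close> has finite support form a free
  ideal that omits \<open>f\<close>.\<close>

section \<open>Functions of finite support are Baire one\<close>

lemma normal_space_euclidean_t4: "normal_space (euclidean :: 'a::t4_space topology)"
  unfolding normal_space_def disjnt_def
  by (metis closed_closedin open_openin t4_space)

lemma baire_one_indicator_singleton:
  fixes p :: "'a::t4_space"
  assumes "gdelta {p}"
  shows "baire_one (indicator {p})"
proof -
  obtain U :: "nat \<Rightarrow> 'a set" where U: "\<And>n. open (U n)" "{p} = (\<Inter>n. U n)"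
    using assms by (cases rule: gdelta.cases) blast
  \<comment> \<open>Finite intersections make the neighbourhoods decreasing: a point outside
    \<open>U k\<close> is outside every \<open>V n\<close> with n \<ge> k, so the approximants
    vanish there eventually and not just at one index.\<close>
  define V where "V n = (\<Inter>k\<le>n. U k)" for n
  have "open (V n)" for n
    using U(1) unfolding V_def by (intro open_INT) auto
  moreover have "p \<in> V n" for n
    using U(2) unfolding V_def by blast
  ultimately have "\<exists>g :: 'a \<Rightarrow> real. continuous_on UNIV g \<and> g p = 1 \<and> (\<forall>x. x \<notin> V n \<longrightarrow> g x = 0)"
    for n
    \<comment> \<open>Urysohn's lemma for the disjoint closed sets \<open>{p}\<close> and
      \<open>- V n\<close>, with values 1 and 0.\<close>
    using normal_space_euclidean_t4[THEN normal_space_iff_Urysohn_gen_alt[of "1::real" 0,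
        OF one_neq_zero, THEN iffD1], THEN spec[of _ "{p}"], THEN spec[of _ "- V n"]]
    by (auto simp: disjnt_def image_subset_iff simp flip: closed_closedin)
  then obtain g :: "nat \<Rightarrow> 'a \<Rightarrow> real" where g: "\<And>n. continuous_on UNIV (g n)" "\<And>n. g n p = 1"
      "\<And>n x. x \<notin> V n \<Longrightarrow> g n x = 0"
    by metis
  have "(\<lambda>n. g n x) \<longlonglongrightarrow> indicator {p} x" for x
  proof (cases "x = p")
    case False
    then obtain k where "x \<notin> U k"
      using U(2) by blast
    then have "\<forall>\<^sub>F n in sequentially. g n x = 0"
      unfolding eventually_sequentially V_def
      by (intro exI[of _ k]) (auto intro!: g(3) simp: V_def)
    then show ?thesis
      using False by (simp add: tendsto_eventually)
  qed (simp add: g(2))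
  then show ?thesis
    unfolding baire_one_def using g(1) by blast
qed

lemma baire_one_finite_support:
  fixes f :: "'a::t4_space \<Rightarrow> real"
  assumes "\<forall>p :: 'a. gdelta {p}" and "finite {x. f x \<noteq> 0}"
  shows "baire_one f"
proof -
  have "baire_one (\<lambda>x. \<Sum>p\<in>S. f p * indicator {p} x)" if "finite S" for S
    using that
    by induction (simp_all add: baire_one_const baire_one_add baire_one_mult
        baire_one_indicator_singleton assms(1) del: sum_mult_indicator)
  moreover have "(\<lambda>x. \<Sum>p\<in>{x. f x \<noteq> 0}. f p * indicator {p} x) = f"
  proof
    fix x show "(\<Sum>p\<in>{x. f x \<noteq> 0}. f p * indicator {p} x) = f x"
      using assms(2) by (cases "f x = 0") (simp_all add: indicator_def)
  qed
  ultimately show ?thesis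
    using assms(2) by metis
qed

text \<open>Captures what \<open>B1\<close> and \<open>B1_star\<close> share, so that (v) is proved
  once for both. The operations are always pointwise; only the carrier varies.\<close>

locale finite_support_ring = cring R for R :: "('a \<Rightarrow> real) ring" (structure) +
  assumes fun_ring_restrict: "R = fun_ring\<lparr>carrier := carrier R\<rparr>"
    and finite_support_closed: "finite {x. f x \<noteq> 0} \<Longrightarrow> f \<in> carrier R"
begin

lemma mult_eq: "f \<otimes> g = (\<lambda>x. f x * g x)"
  by (subst fun_ring_restrict) (simp add: fun_ring_def)

lemma add_eq: "f \<oplus> g = (\<lambda>x. f x + g x)"
  by (subst fun_ring_restrict) (simp add: fun_ring_def)

lemma zero_eq: "\<zero> = (\<lambda>x. 0)"
  by (subst fun_ring_restrict) (simp add: fun_ring_def)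

lemma finsum_eq:
  assumes "a \<in> F \<rightarrow> carrier R" and "finite F"
  shows "finsum R a F = (\<lambda>x. \<Sum>i\<in>F. a i x)"
  using assms(2,1) by induction (auto simp: zero_eq add_eq Pi_iff)

text \<open>Closure under negation comes from absorption, since -f is the product of f with the
  constant -1.\<close>

lemma ideal_funI:
  assumes "I \<subseteq> carrier R" and "(\<lambda>x. 0) \<in> I"
    and "\<And>f g. f \<in> I \<Longrightarrow> g \<in> I \<Longrightarrow> (\<lambda>x. f x + g x) \<in> I"
    and "\<And>f g. f \<in> I \<Longrightarrow> g \<in> carrier R \<Longrightarrow> (\<lambda>x. g x * f x) \<in> I"
  shows "ideal I R"
proof (rule idealI)
  have "\<ominus> f \<in> I" if "f \<in> I" for f
  proof -
    have "\<ominus> f = \<ominus> \<one> \<otimes> f"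
      using that assms(1) by (auto simp: l_minus)
    then show ?thesis
      using assms(4)[OF that, of "\<ominus> \<one>"] by (simp add: mult_eq)
  qed
  then show "subgroup I (add_monoid R)"
    using assms by (intro group.subgroupI[OF a_group]) (auto simp: add_eq a_inv_def)
next
  fix f g assume "f \<in> I" and "g \<in> carrier R"
  then show "g \<otimes> f \<in> I" and "f \<otimes> g \<in> I"
    using assms(4)[of f g] by (simp_all add: mult_eq mult.commute)
qed (rule ring_axioms)

section \<open>Minimal ideals: the real multiples of the indicator of a point\<close>

definition point_ideal :: "'a \<Rightarrow> ('a \<Rightarrow> real) set" where
  "point_ideal p = {f. \<forall>x. x \<noteq> p \<longrightarrow> f x = 0}"

lemma point_ideal_finite_support:
  assumes "f \<in> point_ideal p"
  shows "finite {x. f x \<noteq> 0}"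
  by (rule finite_subset[of _ "{p}"]) (use assms in \<open>auto simp: point_ideal_def\<close>)

lemma point_ideal_carrier: "point_ideal p \<subseteq> carrier R"
  using point_ideal_finite_support finite_support_closed by blast

lemma ideal_point_ideal: "ideal (point_ideal p) R"
  by (rule ideal_funI) (use point_ideal_carrier in \<open>auto simp: point_ideal_def\<close>)

lemma indicator_in_point_ideal: "indicator {p} \<in> point_ideal p"
  by (simp add: point_ideal_def)

lemma point_ideal_nonzero: "point_ideal p \<noteq> {\<zero>}"
proof -
  have "indicator {p} \<noteq> \<zero>"
    by (metis indicator_simps(1) insertI1 zero_eq zero_neq_one)
  then show ?thesis
    using indicator_in_point_ideal by blast
qed

lemma inj_point_ideal: "point_ideal p = point_ideal q \<Longrightarrow> p = q"
  using indicator_in_point_ideal[of p] by (force simp: point_ideal_def indicator_def)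

lemma point_ideal_subset_ideal:
  assumes "ideal I R" and "f \<in> I" and "f p \<noteq> 0"
  shows "point_ideal p \<subseteq> I"
proof
  fix g assume g: "g \<in> point_ideal p"
  \<comment> \<open>Like \<open>g\<close>, this quotient vanishes off \<open>p\<close>, so it lies
    in the ring whether or not 1 / f does.\<close>
  define h where "h = (\<lambda>x. g x / f p)"
  have "h \<in> point_ideal p"
    using g by (simp add: h_def point_ideal_def)
  then have "h \<otimes> f \<in> I"
    using assms point_ideal_carrier by (blast intro: ideal.I_l_closed)
  also have "h \<otimes> f = g"
  proof
    fix x show "(h \<otimes> f) x = g x"
      using g assms(3) by (cases "x = p") (auto simp: mult_eq h_def point_ideal_def)
  qed
  finally show "g \<in> I" .
qed

text \<open>Any point where some member does not vanish will do. Minimality, the count of zero sets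
  and essentiality all rest on this.\<close>

lemma nonzero_ideal_contains_point_ideal:
  assumes "ideal I R" and "I \<noteq> {\<zero>}"
  obtains p where "point_ideal p \<subseteq> I"
proof -
  have "\<zero> \<in> I"
    using assms(1) by (simp add: additive_subgroup.zero_closed ideal.axioms(1))
  with assms(2) obtain f where "f \<in> I" "f \<noteq> \<zero>"
    by blast
  then obtain p where "f p \<noteq> 0"
    by (auto simp: zero_eq)
  then show ?thesis
    using that point_ideal_subset_ideal assms(1) \<open>f \<in> I\<close> by blast
qed

text \<open>Links point ideals to the generators in (i): the indicator does not vanish at
  \<open>p\<close>, and it already lies in the ideal \<open>point_ideal p\<close>.\<close>

lemma genideal_indicator: "Idl {indicator {p}} = point_ideal p"
proof
  have "indicator {p} \<in> carrier R"
    using indicator_in_point_ideal point_ideal_carrier by blast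
  then have "ideal (Idl {indicator {p}}) R" and "indicator {p} \<in> Idl {indicator {p}}"
    by (simp_all add: genideal_ideal genideal_self')
  then show "point_ideal p \<subseteq> Idl {indicator {p}}"
    by (rule point_ideal_subset_ideal) simp
  show "Idl {indicator {p}} \<subseteq> point_ideal p"
    by (rule genideal_minimal) (simp_all add: ideal_point_ideal indicator_in_point_ideal)
qed

text \<open>Every nonzero ideal contains a point ideal, and point ideals of distinct points are
  incomparable.\<close>

lemma minimal_ideal_iff: "minimal_ideal R I \<longleftrightarrow> (\<exists>p. I = point_ideal p)"
proof
  assume I: "minimal_ideal R I"
  then obtain p where "point_ideal p \<subseteq> I"
    unfolding minimal_ideal_def using nonzero_ideal_contains_point_ideal by blast
  then show "\<exists>p. I = point_ideal p"
    using I ideal_point_ideal point_ideal_nonzero unfolding minimal_ideal_def by blast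
next
  assume "\<exists>p. I = point_ideal p"
  then obtain p where I: "I = point_ideal p" ..
  have "J = I" if J: "ideal J R" "J \<noteq> {\<zero>}" "J \<subseteq> I" for J
  proof -
    obtain q where q: "point_ideal q \<subseteq> J"
      using nonzero_ideal_contains_point_ideal J by blast
    then have "indicator {q} \<in> point_ideal p"
      using J(3) I indicator_in_point_ideal by blast
    then have "q = p"
      by (auto simp: point_ideal_def indicator_def split: if_splits)
    then show ?thesis
      using q J(3) I by blast
  qed
  then show "minimal_ideal R I"
    unfolding minimal_ideal_def using I ideal_point_ideal point_ideal_nonzero by blast
qed

lemma zero_sets_point_ideal: "zero_sets (point_ideal p) = {UNIV, - {p}}"
proof
  show "zero_sets (point_ideal p) \<subseteq> {UNIV, - {p}}"
    by (auto simp: zero_sets_def zero_set_def point_ideal_def)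
  have "zero_set (\<lambda>x. 0) = UNIV" "zero_set (indicator {p}) = - {p}"
    by (auto simp: zero_set_def indicator_def)
  moreover have "(\<lambda>x. 0) \<in> point_ideal p"
    by (simp add: point_ideal_def)
  ultimately show "{UNIV, - {p}} \<subseteq> zero_sets (point_ideal p)"
    unfolding zero_sets_def using indicator_in_point_ideal by (auto intro: rev_image_eqI)
qed

lemma card_zero_sets_point_ideal: "card (zero_sets (point_ideal p)) = 2"
proof -
  have "UNIV \<noteq> - {p}"
    by blast
  then show ?thesis
    by (simp add: zero_sets_point_ideal)
qed

text \<open>The two zero sets of a point ideal inside \<open>I\<close> already exhaust those of
  \<open>I\<close>, so every member of \<open>I\<close> vanishes off that one point.\<close>

lemma minimal_ideal_iff_card_zero_sets:
  assumes "ideal I R" and "I \<noteq> {\<zero>}"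
  shows "minimal_ideal R I \<longleftrightarrow> card (zero_sets I) = 2"
proof
  assume card: "card (zero_sets I) = 2"
  obtain p where p: "point_ideal p \<subseteq> I"
    using nonzero_ideal_contains_point_ideal assms by blast
  then have "zero_sets (point_ideal p) \<subseteq> zero_sets I"
    by (auto simp: zero_sets_def)
  \<comment> \<open>Infinite sets have \<open>card\<close> 0, so the value 2 forces
    finiteness.\<close>
  moreover have "finite (zero_sets I)"
    using card by (simp add: card_ge_0_finite)
  ultimately have "zero_sets I = {UNIV, - {p}}"
    using card card_zero_sets_point_ideal zero_sets_point_ideal by (metis card_subset_eq)
  then have "zero_set g = UNIV \<or> zero_set g = - {p}" if "g \<in> I" for g
    using that unfolding zero_sets_def by blast
  then have "I \<subseteq> point_ideal p"
    unfolding zero_set_def point_ideal_def by fast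
  then show "minimal_ideal R I"
    using p minimal_ideal_iff by blast
next
  assume "minimal_ideal R I"
  then obtain p where "I = point_ideal p"
    using minimal_ideal_iff by metis
  then show "card (zero_sets I) = 2"
    using card_zero_sets_point_ideal by metis
qed

section \<open>The socle and its essentiality\<close>

lemma socle_eq: "socle R = {f. finite {x. f x \<noteq> 0}}"
proof (intro equalityI subsetI)
  fix f assume "f \<in> socle R"
  then obtain a F where F: "f = finsum R a F" "finite F" "F \<subseteq> {I. minimal_ideal R I}"
      "\<forall>I\<in>F. a I \<in> I"
    unfolding socle_def sum_of_ideals_def by blast
  have a: "a I \<in> carrier R \<and> finite {x. a I x \<noteq> 0}" if "I \<in> F" for I
    using that F(3,4) minimal_ideal_iff point_ideal_finite_support finite_support_closed by blast
  have "f = (\<lambda>x. \<Sum>I\<in>F. a I x)"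
    using F(1,2) a by (simp add: finsum_eq Pi_iff)
  \<comment> \<open>A sum can be nonzero at x only if one of its summands is.\<close>
  then have "{x. f x \<noteq> 0} \<subseteq> (\<Union>I\<in>F. {x. a I x \<noteq> 0})"
    by (auto dest: sum.not_neutral_contains_not_neutral)
  then show "f \<in> {f. finite {x. f x \<noteq> 0}}"
    using a F(2) by (auto intro: finite_subset)
next
  fix f :: "'a \<Rightarrow> real" assume "f \<in> {f. finite {x. f x \<noteq> 0}}"
  then have fin: "finite {x. f x \<noteq> 0}"
    by simp
  define F where "F = point_ideal ` {x. f x \<noteq> 0}"
  \<comment> \<open>Summands are indexed by ideals, not points, so \<open>a I\<close> has to recover
    the point from \<open>I\<close>. By injectivity of \<open>point_ideal\<close>, at most one x
    matches, and \<open>a I\<close> is f cut down to that point.\<close>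
  define a where "a I = (\<lambda>x. if point_ideal x = I then f x else 0)" for I
  have "finite F"
    using fin by (simp add: F_def)
  have "a (point_ideal p) \<in> point_ideal p" for p
    using inj_point_ideal by (auto simp: point_ideal_def[of p, THEN eqset_imp_iff] a_def)
  then have a: "\<forall>I\<in>F. a I \<in> I"
    by (simp add: F_def)
  then have "a \<in> F \<rightarrow> carrier R"
    using point_ideal_carrier unfolding F_def by blast
  \<comment> \<open>At a fixed x only the index \<open>point_ideal x\<close> contributes.\<close>
  then have "finsum R a F = (\<lambda>x. if point_ideal x \<in> F then f x else 0)"
    using \<open>finite F\<close> by (simp add: finsum_eq a_def sum.delta')
  also have "\<dots> = f"
    by (rule ext) (auto simp: F_def)
  finally have "f = finsum R a F" ..
  moreover have "F \<subseteq> {I. minimal_ideal R I}"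
    by (auto simp: F_def minimal_ideal_iff)
  ultimately show "f \<in> socle R"
    unfolding socle_def sum_of_ideals_def using \<open>finite F\<close> a by blast
qed

lemma point_ideal_subset_socle: "point_ideal p \<subseteq> socle R"
  using point_ideal_finite_support by (auto simp: socle_eq)

lemma ideal_socle: "ideal (socle R) R"
proof (rule ideal_funI)
  fix f g assume "f \<in> socle R" "g \<in> socle R"
  moreover have "{x. f x + g x \<noteq> 0} \<subseteq> {x. f x \<noteq> 0} \<union> {x. g x \<noteq> 0}"
    by auto
  ultimately show "(\<lambda>x. f x + g x) \<in> socle R"
    by (auto simp: socle_eq intro: finite_subset)
qed (auto simp: socle_eq finite_support_closed)

text \<open>A nonzero ideal contains a point ideal, and all point ideals lie in the socle.\<close>

lemma essential_ideal_socle: "essential_ideal R (socle R)"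
proof -
  have "socle R \<inter> J \<noteq> {\<zero>}" if J: "ideal J R" "J \<noteq> {\<zero>}" for J
  proof -
    obtain p where "point_ideal p \<subseteq> J"
      using nonzero_ideal_contains_point_ideal J by blast
    then have "indicator {p} \<in> socle R \<inter> J" "(\<lambda>x. 0) \<in> socle R \<inter> J"
      using point_ideal_subset_socle[of p] by (auto simp: point_ideal_def)
    moreover have "indicator {p} \<noteq> (\<lambda>x. 0 :: real)"
      by (metis indicator_simps(1) insertI1 zero_neq_one)
    ultimately show ?thesis
      by (auto simp: zero_eq)
  qed
  moreover have "socle R \<noteq> {\<zero>}"
    using point_ideal_subset_socle point_ideal_nonzero ideal_point_ideal
    by (metis additive_subgroup.zero_closed empty_iff ideal.axioms(1) subset_singletonD)
  ultimately show ?thesis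
    unfolding essential_ideal_def using ideal_socle by blast
qed

section \<open>Free ideals\<close>

lemma Inter_zero_sets_eq_empty_iff:
  assumes "ideal I R"
  shows "\<Inter> (zero_sets I) = {} \<longleftrightarrow> socle R \<subseteq> I"
proof
  assume empty: "\<Inter> (zero_sets I) = {}"
  \<comment> \<open>An empty intersection provides, for each point, a member of \<open>I\<close>
    that does not vanish there.\<close>
  have point: "point_ideal p \<subseteq> I" for p
  proof -
    obtain f where "f \<in> I" "f p \<noteq> 0"
      using empty by (fastforce simp: zero_sets_def zero_set_def)
    then show ?thesis
      using point_ideal_subset_ideal assms by blast
  qed
  show "socle R \<subseteq> I"
  proof
    fix f assume "f \<in> socle R"
    then obtain a F where F: "f = finsum R a F" "finite F" "F \<subseteq> {J. minimal_ideal R J}"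
        "\<forall>J\<in>F. a J \<in> J"
      unfolding socle_def sum_of_ideals_def by blast
    have "a J \<in> I" if "J \<in> F" for J
    proof -
      obtain p where "J = point_ideal p"
        using \<open>J \<in> F\<close> F(3) minimal_ideal_iff by auto
      then show ?thesis
        using \<open>J \<in> F\<close> F(4) point[of p] by auto
    qed
    with \<open>finite F\<close> have "finsum R a F \<in> I"
    proof induction
      case empty
      then show ?case
        by (simp add: additive_subgroup.zero_closed assms ideal.axioms(1))
    next
      case (insert J F)
      then have "a J \<in> I" "a \<in> F \<rightarrow> carrier R" "a J \<in> carrier R"
        using ideal.Icarr[OF assms] by auto
      then show ?case
        using insert by (simp add: additive_subgroup.a_closed assms ideal.axioms(1))
    qed
    then show "f \<in> I"
      by (simp add: F(1))
  qed
next
  assume sub: "socle R \<subseteq> I"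
  \<comment> \<open>Each point is excluded by the zero set of its own indicator, which belongs to
    the socle.\<close>
  have "zero_set (indicator {p}) \<in> zero_sets I" for p
    using sub point_ideal_subset_socle indicator_in_point_ideal unfolding zero_sets_def by blast
  moreover have "p \<notin> zero_set (indicator {p})" for p :: 'a
    by (simp add: zero_set_def)
  ultimately show "\<Inter> (zero_sets I) = {}"
    by blast
qed

text \<open>With freeness turned into containment of the socle, one inclusion of (v) is
  immediate.\<close>

lemma free_ideal_iff: "free_ideal R I \<longleftrightarrow> ideal I R \<and> I \<noteq> carrier R \<and> socle R \<subseteq> I"
  unfolding free_ideal_def fixed_ideal_def using Inter_zero_sets_eq_empty_iff[of I] by argo

text \<open>Infinitude makes the socle proper: the constant 1 is supported on the whole
  space.\<close>

lemma free_ideal_socle: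
  assumes "infinite (UNIV :: 'a set)"
  shows "free_ideal R (socle R)"
proof -
  have "\<one> = (\<lambda>x. 1)"
    by (subst fun_ring_restrict) (simp add: fun_ring_def)
  then have "\<one> \<notin> socle R"
    using assms by (simp add: socle_eq)
  then show ?thesis
    using ideal_socle free_ideal_iff by auto
qed

lemma free_ideal_omitting:
  assumes "f \<in> carrier R" and "f \<notin> socle R"
  obtains I where "free_ideal R I" and "f \<notin> I"
proof -
  \<comment> \<open>This is the colon ideal of the socle by \<open>f\<close>: the set in braces is
    the support of g f.\<close>
  define I where "I = {g \<in> carrier R. finite {x. g x \<noteq> 0 \<and> f x \<noteq> 0}}"
  have "ideal I R"
  proof (rule ideal_funI)
    fix g h assume "g \<in> I" "h \<in> I"
    moreover have "{x. g x + h x \<noteq> 0 \<and> f x \<noteq> 0} \<subseteq>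
        {x. g x \<noteq> 0 \<and> f x \<noteq> 0} \<union> {x. h x \<noteq> 0 \<and> f x \<noteq> 0}"
      by auto
    ultimately show "(\<lambda>x. g x + h x) \<in> I"
      using a_closed[of g h] unfolding I_def by (auto simp: add_eq intro: finite_subset)
  next
    fix g h assume "g \<in> I" "h \<in> carrier R"
    moreover have "{x. h x * g x \<noteq> 0 \<and> f x \<noteq> 0} \<subseteq> {x. g x \<noteq> 0 \<and> f x \<noteq> 0}"
      by auto
    ultimately show "(\<lambda>x. h x * g x) \<in> I"
      using m_closed[of h g] unfolding I_def by (auto simp: mult_eq intro: finite_subset)
  qed (auto simp: I_def finite_support_closed)
  \<comment> \<open>The square of \<open>f\<close> has the same support as \<open>f\<close>, which
    is infinite.\<close>
  moreover have "f \<notin> I"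
    using assms(2) by (simp add: I_def socle_eq)
  moreover have "socle R \<subseteq> I"
    by (auto simp: I_def socle_eq finite_support_closed)
  \<comment> \<open>Since \<open>f\<close> is in the ring but not in \<open>I\<close>, the ideal is
    proper.\<close>
  ultimately show ?thesis
    using that assms(1) by (auto simp: free_ideal_iff)
qed

text \<open>Meeting with \<open>carrier R\<close> fixes the value when there are no free ideals, as
  over a finite space: the bare intersection would then be \<open>UNIV\<close> by
  convention.\<close>

lemma socle_eq_Inter_free_ideals: "socle R = carrier R \<inter> \<Inter> {I. free_ideal R I}"
proof
  show "socle R \<subseteq> carrier R \<inter> \<Inter> {I. free_ideal R I}"
    using ideal.Icarr[OF ideal_socle] by (auto simp: free_ideal_iff)
  show "carrier R \<inter> \<Inter> {I. free_ideal R I} \<subseteq> socle R"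
  proof
    fix f assume f: "f \<in> carrier R \<inter> \<Inter> {I. free_ideal R I}"
    show "f \<in> socle R"
    proof (rule ccontr)
      assume "f \<notin> socle R"
      with f obtain I where "free_ideal R I" "f \<notin> I"
        using free_ideal_omitting[of f] by auto
      with f show False
        by auto
    qed
  qed
qed

end

section \<open>Application to \<open>B1\<close> and \<open>B1_star\<close>\<close>

lemma bounded_range_finite_support:
  fixes f :: "'a \<Rightarrow> real"
  assumes "finite {x. f x \<noteq> 0}"
  shows "bounded (range f)"
proof -
  have "range f \<subseteq> insert 0 (f ` {x. f x \<noteq> 0})"
    by auto
  then show ?thesis
    using assms by (meson bounded_subset finite_imageI finite_imp_bounded finite_insert)
qed

theorem proposition2p3:
  assumes "\<forall>p :: 'a::t4_space. gdelta {p}"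
  shows
    "(\<forall>I :: ('a \<Rightarrow> real) set. ideal I B1 \<and> I \<noteq> {\<zero>\<^bsub>B1\<^esub>} \<longrightarrow>
        (minimal_ideal B1 I \<longleftrightarrow> (\<exists>p. I = Idl\<^bsub>B1\<^esub> {indicator {p}}))) \<and>
     (\<forall>I :: ('a \<Rightarrow> real) set. ideal I B1 \<and> I \<noteq> {\<zero>\<^bsub>B1\<^esub>} \<longrightarrow>
        (minimal_ideal B1 I \<longleftrightarrow> card (zero_sets I) = 2)) \<and>
     socle B1 = {f :: 'a \<Rightarrow> real. finite {x. f x \<noteq> 0}} \<and>
     (essential_ideal B1 (socle (B1 :: ('a \<Rightarrow> real) ring)) \<and>
      \<Inter> (zero_sets (socle (B1 :: ('a \<Rightarrow> real) ring))) = {} \<and>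
      (infinite (UNIV :: 'a set) \<longrightarrow> free_ideal B1 (socle (B1 :: ('a \<Rightarrow> real) ring)))) \<and>
     (socle (B1 :: ('a \<Rightarrow> real) ring) = carrier B1 \<inter> \<Inter> {I. free_ideal B1 I} \<and>
      socle (B1 :: ('a \<Rightarrow> real) ring) = carrier B1_star \<inter> \<Inter> {I. free_ideal B1_star I})"
proof -
  interpret B1: finite_support_ring "B1 :: ('a \<Rightarrow> real) ring"
    by (intro finite_support_ring.intro finite_support_ring_axioms.intro cring_B1)
       (use assms in \<open>auto simp: B1_def baire_one_finite_support\<close>)
  interpret B1_star: finite_support_ring "B1_star :: ('a \<Rightarrow> real) ring"
    by (intro finite_support_ring.intro finite_support_ring_axioms.intro cring_B1_star)
       (use assms in \<open>auto simp: B1_star_def baire_one_finite_support bounded_range_finite_support\<close>)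
  show ?thesis
  proof (intro conjI allI impI)
    fix I :: "('a \<Rightarrow> real) set" assume "ideal I B1 \<and> I \<noteq> {\<zero>\<^bsub>B1\<^esub>}"
    then show "minimal_ideal B1 I \<longleftrightarrow> card (zero_sets I) = 2"
      by (intro B1.minimal_ideal_iff_card_zero_sets) auto
    show "minimal_ideal B1 I \<longleftrightarrow> (\<exists>p. I = Idl\<^bsub>B1\<^esub> {indicator {p}})"
      by (simp only: B1.minimal_ideal_iff B1.genideal_indicator)
  next
    show "\<Inter> (zero_sets (socle (B1 :: ('a \<Rightarrow> real) ring))) = {}"
      using B1.Inter_zero_sets_eq_empty_iff B1.ideal_socle by blast
  next
    \<comment> \<open>The description by finite support does not mention the ring, so both socles
      coincide and the result for \<open>B1_star\<close> speaks of the socle of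
      \<open>B1\<close>.\<close>
    have "socle (B1 :: ('a \<Rightarrow> real) ring) = socle B1_star"
      by (simp only: B1.socle_eq B1_star.socle_eq)
    then show "socle (B1 :: ('a \<Rightarrow> real) ring) = carrier B1_star \<inter> \<Inter> {I. free_ideal B1_star I}"
      by (simp only: B1_star.socle_eq_Inter_free_ideals)
  qed (fact B1.socle_eq B1.essential_ideal_socle B1.free_ideal_socle B1.socle_eq_Inter_free_ideals)+
qed

end
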